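(* Let $f:\mathbb{R}^d\to\mathbb{R}$ be $C^1$ with $\nabla f$ Lipschitz continuous on $\mathbb{R}^d$ with constant $L>0$, bounded from below, with set of minimizers $\mathcal M=\{x: f(x)=\inf f\}$. Let $\mu>0$, $0<\eta\le 1/L$ and $\rho=\frac{1-\sqrt{\mu\eta}}{1+\sqrt{\mu\eta}}$. Assume that the closest point projection onto $\mathcal M$ is an affine linear map $\pi(x)=Px+x^*$ as described in the context, that $$\langle\nabla f(x),x-\pi(x)\rangle\ge f(x)-f(\pi(x))+\frac{\mu}{2}\|x-\pi(x)\|^2\qquad\text{for all }x\in\mathbb{R}^d,$$ and that for some $\varepsilon\le\sqrt{\mu/\eta}$ $$\langle\nabla f(x+v),v\rangle\ge f(x+v)-f(x)-\frac{\varepsilon}{2}\|v\|^2\qquad\text{for all }x,v\in\mathbb{R}^d.$$ Let $(\Omega,\mathcal A,\mathbb Q)$ be a probability space and $g:\mathbb{R}^d\times\Omega\to\mathbb{R}^d$ a measurable function such that for all $x\in\mathbb{R}^d$ $$\mathbb{E}_{\omega\sim\mathbb Q}[g(x,\omega)]=\nabla f(x),\qquad \mathbb{E}_{\omega\sim\mathbb Q}[\|g(x,\omega)\|^2]<\infty,\qquad \mathbb{E}_{\omega\sim\mathbb Q}[\|g(x,\omega)-\nabla f(x)\|^2]\le\sigma_a^2$$ for some $\sigma_a\ge 0$. Let $x_0$ be a (possibly random) initial condition in $\mathbb{R}^d$, $v_0=0$, let $\omega_0,\omega_1,\dots$ be drawn with law $\mathbb Q$ independently of each other and of $x_0$, and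 let $$x_n'=x_n+\sqrt{\eta}\,v_n,\qquad g_n=g(x_n',\omega_n),\qquad x_{n+1}=x_n'-\eta g_n,\qquad v_{n+1}=\rho\,(v_n-\sqrt{\eta}\,g_n).$$ Then for all $n\ge 0$ $$\mathbb{E}[f(x_n)-\inf f]\le(1-\sqrt{\mu\eta})^n\,\mathbb{E}\left[f(x_0)-\inf f+\frac{\mu}{2}\|x_0-\pi(x_0)\|^2\right]+\frac{\sigma_a^2\sqrt{\eta}}{\sqrt{\mu}}.$$
   Context: Affine projection: $V\subset\mathbb{R}^d$ is a linear subspace of dimension $k<d$, $P:\mathbb{R}^d\to\mathbb{R}^d$ is the orthogonal projection onto $V$, $x^*$ is the (unique) element of smallest Euclidean norm in the affine space $x^*+V$ (equivalently $x^*\perp V$), the set of minimizers $\mathcal M=\{x\in\mathbb{R}^d: f(x)=\inf_{z} f(z)\}$ is non-empty and equals $x^*+V$, and $\pi(x)=Px+x^*$ is the closest point projection onto $\mathcal M$. Unsubscripted expectations are over $x_0$ and all $\omega_i$. *)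

theory Defs
  imports "HOL-Probability.Probability"
begin

definition minimizers :: "('a \<Rightarrow> real) \<Rightarrow> 'a set" where
  "minimizers f = {x. f x = (INF z. f z)}"

definition is_orthogonal_projection ::
    "'a::real_inner set \<Rightarrow> ('a \<Rightarrow> 'a) \<Rightarrow> bool" where
  "is_orthogonal_projection V P \<longleftrightarrow> (\<forall>x. P x \<in> V \<and> (\<forall>v\<in>V. orthogonal (x - P x) v))"

text \<open>
  Mutual independence of the whole family consisting of \<open>X\<close> (index \<^term>\<open>None\<close>) and of all
  \<open>W i\<close> (index \<^term>\<open>Some i\<close>). This is what \<open>indep_vars\<close> unfolds to;
  \<open>indep_vars\<close> itself requires all members of the family to have the same codomain type.
\<close>
definition indep_initial_samples ::
    "'m measure \<Rightarrow> 'a measure \<Rightarrow> ('m \<Rightarrow> 'a) \<Rightarrow> 'w measure \<Rightarrow> (nat \<Rightarrow> 'm \<Rightarrow> 'w) \<Rightarrow> bool" where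
  "indep_initial_samples M A X Q W \<longleftrightarrow>
     X \<in> measurable M A \<and> (\<forall>i. W i \<in> measurable M Q) \<and>
     prob_space.indep_sets M
       (case_option {X -` S \<inter> space M |S. S \<in> sets A}
                    (\<lambda>i. {W i -` S \<inter> space M |S. S \<in> sets Q})) UNIV"

end

theory Submission imports Defs begin

text \<open>
  The proof is by a Lyapunov function. Put \<open>s = sqrt (\<mu> \<eta>)\<close>, let \<open>N = I - P\<close> project onto the
  normal directions of the affine space of minimizers, and let \<open>y = x + sqrt \<eta> v\<close> be the point
  at which the gradient is sampled. The energy of a state \<open>(x, v)\<close> is
  \[ f(x) - \inf f + \frac12 \|N v + \sqrt\mu\,(y - \pi(y))\|^2
       + \frac{(1+s)^2}{2(1-s)} \|P v\|^2 . \]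
  It dominates the objective gap, and at \<open>v = 0\<close> it is the initial quantity in the theorem.

  Normal and tangential directions are treated separately because only the normal part of the
  velocity can be compared with the displacement \<open>y - \<pi>(y)\<close>, for which there is a strong convexity
  inequality. The two parts match in the terms linear in the gradient: in the update the normal
  vector becomes \<open>(1 - s) N v + sqrt \<mu> (y - \<pi>(y)) - sqrt \<eta> N g\<close>, since
  \<open>\<rho> (1 + s) = 1 - s\<close>, and the weight of the tangential part is the one for which multiplication
  with \<open>\<rho>\<^sup>2\<close> gives \<open>1 - s\<close>. So the gradient meets the full velocity \<open>v\<close> with the
  single coefficient \<open>1 - s\<close>, which is what the inequality for \<open>\<nabla>f(x + v) \<bullet> v\<close> bounds, and
  it meets the displacement with coefficient \<open>s\<close>. The negative curvature
  allowed by \<open>\<epsilon>\<close> costs at most \<open>s/2\<close> times \<open>\<parallel>v\<parallel>\<^sup>2\<close>, as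
  \<open>\<epsilon> \<eta> \<le> s\<close>; in normal directions this completes a square exactly, and in tangential directions the
  weight leaves room for it. The outcome (lemma \<open>energy_step\<close>) is a pointwise inequality
  \[ E_{n+1} \le (1-s) E_n + \langle A, \xi\rangle + \eta \|\xi\|^2 , \]
  with \<open>\<xi>\<close> the error of the gradient estimate and \<open>A\<close> depending on the state only.

  A fresh sample is independent of the current state (lemma \<open>distr_iterate_next_sample\<close>), so by
  Tonelli one may first integrate over the sample alone: the linear term vanishes, the
  quadratic one is at most \<open>\<eta> \<sigma>\<^sup>2\<close>. The affine recursion
  \<open>e (n + 1) \<le> (1 - s) e n + \<eta> \<sigma>\<^sup>2\<close> has fixed point \<open>\<eta> \<sigma>\<^sup>2 / s\<close>, the noise term of the theorem.
  Nonnegative integrals are used throughout, so that an initial law of infinite energy is covered.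
\<close>

section \<open>Orthogonal projections and Lipschitz gradients\<close>

lemma orthogonal_projection_eqI:
  fixes V :: "'a::real_inner set"
  assumes "subspace V" "is_orthogonal_projection V P" "w \<in> V" "\<And>v. v \<in> V \<Longrightarrow> orthogonal (x - w) v"
  shows "P x = w"
proof -
  have d: "P x - w \<in> V"
    using assms by (auto simp: is_orthogonal_projection_def intro: subspace_diff)
  have "(x - w) \<bullet> (P x - w) = 0" "(x - P x) \<bullet> (P x - w) = 0"
    using assms d by (auto simp: is_orthogonal_projection_def orthogonal_def)
  then have "(P x - w) \<bullet> (P x - w) = 0" by (simp add: inner_diff_left)
  then show ?thesis by simp
qed

lemma orthogonal_projection_linear:
  fixes V :: "'a::real_inner set"
  assumes "subspace V" "is_orthogonal_projection V P"
  shows "linear P"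
proof (rule linearI)
  have P: "P x \<in> V" "v \<in> V \<Longrightarrow> (x - P x) \<bullet> v = 0" for x v
    using assms by (auto simp: is_orthogonal_projection_def orthogonal_def)
  show "P (x + y) = P x + P y" for x y
  proof (rule orthogonal_projection_eqI[OF assms])
    show "P x + P y \<in> V" using assms P by (simp add: subspace_add)
    show "orthogonal (x + y - (P x + P y)) v" if "v \<in> V" for v
      using P(2)[OF that, of x] P(2)[OF that, of y]
      by (simp add: orthogonal_def inner_diff_left inner_add_left)
  qed
  show "P (r *\<^sub>R x) = r *\<^sub>R P x" for r x
  proof (rule orthogonal_projection_eqI[OF assms])
    show "r *\<^sub>R P x \<in> V" using assms P by (simp add: subspace_scale)
    show "orthogonal (r *\<^sub>R x - r *\<^sub>R P x) v" if "v \<in> V" for v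
      using P(2)[OF that, of x]
      by (simp add: orthogonal_def inner_diff_left flip: scaleR_diff_right)
  qed
qed

text \<open>
  Along the segment from \<open>y\<close> to \<open>y + h\<close> the difference of the two sides has a derivative of
  constant sign, by the Lipschitz bound and Cauchy-Schwarz.
\<close>

lemma lipschitz_gradient_upper_bound:
  fixes f :: "'a::real_inner \<Rightarrow> real"
  assumes gradient: "\<And>y. GDERIV f y :> G y" and lipschitz: "L-lipschitz_on UNIV G"
  shows "f (y + h) \<le> f y + G y \<bullet> h + L / 2 * (norm h)\<^sup>2"
proof -
  define \<phi> where "\<phi> t = f (y + t *\<^sub>R h) - t * (G y \<bullet> h) - L / 2 * t\<^sup>2 * (norm h)\<^sup>2" for t
  define \<phi>' where "\<phi>' t = G (y + t *\<^sub>R h) \<bullet> h - G y \<bullet> h - L * t * (norm h)\<^sup>2" for t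
  have deriv: "DERIV \<phi> t :> \<phi>' t" for t
  proof -
    have "((\<lambda>t. y + t *\<^sub>R h) has_derivative (\<lambda>s. s *\<^sub>R h)) (at t)"
      by (auto intro!: derivative_eq_intros)
    moreover have "(f has_derivative (\<lambda>k. k \<bullet> G (y + t *\<^sub>R h))) (at (y + t *\<^sub>R h))"
      using gradient[of "y + t *\<^sub>R h"] by (simp add: gderiv_def)
    ultimately have "((\<lambda>t. f (y + t *\<^sub>R h)) has_derivative (\<lambda>s. (s *\<^sub>R h) \<bullet> G (y + t *\<^sub>R h))) (at t)"
      by (rule has_derivative_compose)
    then have "DERIV (\<lambda>t. f (y + t *\<^sub>R h)) t :> G (y + t *\<^sub>R h) \<bullet> h"
      by (simp add: has_field_derivative_def inner_commute mult_commute_abs)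
    then show ?thesis
      unfolding \<phi>_def \<phi>'_def by (auto intro!: derivative_eq_intros)
  qed
  have "\<phi>' t \<le> 0" if "0 \<le> t" for t
  proof -
    have "(G (y + t *\<^sub>R h) - G y) \<bullet> h \<le> norm (G (y + t *\<^sub>R h) - G y) * norm h"
      by (rule norm_cauchy_schwarz)
    also have "\<dots> \<le> (L * norm (t *\<^sub>R h)) * norm h"
      using lipschitz_onD[OF lipschitz, of "y + t *\<^sub>R h" y]
      by (intro mult_right_mono) (auto simp: dist_norm)
    finally show ?thesis
      using that by (simp add: \<phi>'_def inner_diff_left power2_eq_square mult.assoc)
  qed
  then have "\<phi> 1 \<le> \<phi> 0"
    using deriv by (intro DERIV_nonpos_imp_nonincreasing[of 0 1 \<phi>]) auto
  then show ?thesis by (simp add: \<phi>_def)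
qed

text \<open>
  This bound makes the contraction factor \<open>1 - sqrt (\<mu> \<eta>)\<close> nonnegative for step sizes up to
  \<open>1 / L\<close>. A gradient step of size \<open>1 / L\<close> cannot go below \<open>c\<close>, hence
  \<open>\<parallel>G y\<parallel>\<^sup>2 \<le> 2 L (f y - c)\<close>; after Young's inequality for \<open>G y \<bullet> (y - p)\<close> the terms
  \<open>f y - c\<close> cancel and the moduli can be compared.
\<close>

lemma quasi_strong_convexity_modulus_le:
  fixes f :: "'a::real_inner \<Rightarrow> real"
  assumes gradient: "\<And>y. GDERIV f y :> G y" and lipschitz: "L-lipschitz_on UNIV G" and "L > 0"
    and lower: "\<And>z. c \<le> f z"
    and "p \<noteq> y" and convexity: "G y \<bullet> (y - p) \<ge> f y - c + \<mu> / 2 * (norm (y - p))\<^sup>2"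
  shows "\<mu> \<le> L"
proof -
  have "c \<le> f (y + (- (1 / L)) *\<^sub>R G y)" by (rule lower)
  also have "\<dots> \<le> f y + G y \<bullet> ((- (1 / L)) *\<^sub>R G y) + L / 2 * (norm ((- (1 / L)) *\<^sub>R G y))\<^sup>2"
    by (rule lipschitz_gradient_upper_bound[OF gradient lipschitz])
  also have "\<dots> = f y - (norm (G y))\<^sup>2 / (2 * L)"
    using \<open>L > 0\<close> by (simp add: dot_square_norm power_mult_distrib field_simps power2_eq_square)
  finally have gap: "(norm (G y))\<^sup>2 / (2 * L) \<le> f y - c" by simp
  have "0 \<le> (norm (G y) - L * norm (y - p))\<^sup>2 / (2 * L)"
    using \<open>L > 0\<close> by simp
  then have "norm (G y) * norm (y - p) \<le> (norm (G y))\<^sup>2 / (2 * L) + L / 2 * (norm (y - p))\<^sup>2"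
    using \<open>L > 0\<close> by (simp add: power2_diff field_simps power2_eq_square)
  moreover have "G y \<bullet> (y - p) \<le> norm (G y) * norm (y - p)" by (rule norm_cauchy_schwarz)
  ultimately have "\<mu> / 2 * (norm (y - p))\<^sup>2 \<le> L / 2 * (norm (y - p))\<^sup>2"
    using gap convexity by linarith
  then show ?thesis using \<open>p \<noteq> y\<close> by simp
qed

section \<open>The energy of a state and its decay\<close>

text \<open>
  Linearity and the orthogonality condition make \<open>P\<close> the orthogonal projection onto its range.
  With \<open>P x_star = 0\<close> the displacement \<open>y - (P y + x_star)\<close> is normal to that range.
\<close>

locale nesterov =
  fixes f :: "'a::euclidean_space \<Rightarrow> real" and G P :: "'a \<Rightarrow> 'a" and x_star :: 'a
    and f_inf L \<mu> \<eta> \<epsilon> :: real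
  assumes gradient: "\<And>y. GDERIV f y :> G y"
    and lipschitz: "L-lipschitz_on UNIV G"
    and lower: "\<And>y. f_inf \<le> f y"
    and linear_P: "linear P"
    and P_orthogonal: "\<And>u w. (u - P u) \<bullet> P w = 0"
    and P_x_star: "P x_star = 0"
    and mu_pos: "\<mu> > 0" and eta_pos: "\<eta> > 0" and L_eta: "L * \<eta> \<le> 1" and mu_eta: "\<mu> * \<eta> \<le> 1"
    and convexity: "\<And>y. G y \<bullet> (y - (P y + x_star)) \<ge> f y - f_inf + \<mu> / 2 * (norm (y - (P y + x_star)))\<^sup>2"
    and eps_le: "\<epsilon> \<le> sqrt (\<mu> / \<eta>)"
    and almost_convexity: "\<And>y u. G (y + u) \<bullet> u \<ge> f (y + u) - f y - \<epsilon> / 2 * (norm u)\<^sup>2"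
begin

definition "s = sqrt (\<mu> * \<eta>)"
definition "\<rho> = (1 - s) / (1 + s)"
definition "offset y = y - (P y + x_star)"
text \<open>States are pairs of a position and a velocity.\<close>

definition ahead :: "'a \<times> 'a \<Rightarrow> 'a" where "ahead z = fst z + sqrt \<eta> *\<^sub>R snd z"
definition step :: "'a \<times> 'a \<Rightarrow> 'a \<Rightarrow> 'a \<times> 'a" where
  "step z \<gamma> = (ahead z - \<eta> *\<^sub>R \<gamma>, \<rho> *\<^sub>R (snd z - sqrt \<eta> *\<^sub>R \<gamma>))"
text \<open>
  The weight of the tangential part is the number \<open>c\<close> with \<open>c \<rho>\<^sup>2 = 1 - s\<close>. In the extreme
  case \<open>s = 1\<close> one has \<open>\<rho> = 0\<close>, so the velocity vanishes after a step; there the weight is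
  \<open>0\<close> by division by zero, and the identity still holds.
\<close>

definition energy :: "'a \<times> 'a \<Rightarrow> real" where
  "energy z = f (fst z) - f_inf
     + 1 / 2 * (norm (snd z - P (snd z) + sqrt \<mu> *\<^sub>R offset (ahead z)))\<^sup>2
     + (1 + s)\<^sup>2 / (1 - s) / 2 * (norm (P (snd z)))\<^sup>2"

lemma s_pos: "0 < s" and s_le_1: "s \<le> 1"
  using mu_pos eta_pos mu_eta by (auto simp: s_def)

lemma s_eq: "s = sqrt \<mu> * sqrt \<eta>"
  by (simp add: s_def real_sqrt_mult)

lemma energy_ge: "f (fst z) - f_inf \<le> energy z"
  using s_le_1 by (simp add: energy_def)

lemma energy_nonneg: "0 \<le> energy z"
  using energy_ge[of z] lower[of "fst z"] by linarith

lemma P_simps: "P (u + w) = P u + P w" "P (u - w) = P u - P w" "P (r *\<^sub>R u) = r *\<^sub>R P u"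
  using linear_P by (simp_all add: linear_add linear_diff linear_scale)

text \<open>
  The heart of the matter. The vector \<open>A\<close> is chosen before the gradient estimate \<open>\<gamma>\<close>, so that
  it is constant when one averages over \<open>\<gamma>\<close>.
\<close>

lemma energy_step:
  "\<exists>A. \<forall>\<gamma>. energy (step (x, v) \<gamma>) \<le> (1 - s) * energy (x, v)
     + A \<bullet> (\<gamma> - G (x + sqrt \<eta> *\<^sub>R v)) + \<eta> * (norm (\<gamma> - G (x + sqrt \<eta> *\<^sub>R v)))\<^sup>2"
proof -
  define a where "a = sqrt \<eta>"
  define m where "m = sqrt \<mu>"
  define y where "y = x + a *\<^sub>R v"
  define D where "D = offset y"
  define N where "N u = u - P u" for u
  have aa: "a * a = \<eta>" and a0: "0 < a" and mm: "m * m = \<mu>" and sma: "s = m * a" 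
    using eta_pos mu_pos by (simp_all add: a_def m_def s_eq)
  have NP: "N u \<bullet> P w = 0" "P w \<bullet> N u = 0" for u w
    using P_orthogonal by (simp_all add: N_def inner_commute)
  have DP: "D \<bullet> P w = 0" for w
  proof -
    have "x_star \<bullet> P w = 0" using P_orthogonal[of x_star w] by (simp add: P_x_star)
    then show ?thesis using NP(1)[of y w] by (simp add: D_def offset_def N_def inner_diff_left inner_add_left)
  qed
  have split: "u = N u + P u" for u by (simp add: N_def)
  have inner_split: "u \<bullet> w = N u \<bullet> N w + P u \<bullet> P w" for u w
    by (subst (1) split, subst (2) split) (simp add: inner_add_left inner_add_right NP)
  have D_split: "w \<bullet> D = N w \<bullet> D" for w
    using DP[of w] by (simp add: N_def inner_diff_left inner_diff_right inner_commute)
  define p where "p = (1 - s) *\<^sub>R N v + m *\<^sub>R D"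
  define A where "A = - (a *\<^sub>R p) + \<eta> *\<^sub>R N (G y) + (1 - s) *\<^sub>R (\<eta> *\<^sub>R P (G y) - a *\<^sub>R P v)"
  have "energy (step (x, v) \<gamma>) \<le> (1 - s) * energy (x, v) + A \<bullet> (\<gamma> - G y) + \<eta> * (norm (\<gamma> - G y))\<^sup>2" for \<gamma>
  proof -
    define \<xi> where "\<xi> = \<gamma> - G y"
    have \<gamma>: "\<gamma> = G y + \<xi>" by (simp add: \<xi>_def)
    have rho: "\<rho> + \<rho> * s = 1 - s" using s_pos by (simp add: \<rho>_def field_simps)
    have weight: "(1 + s)\<^sup>2 / (1 - s) * \<rho>\<^sup>2 = 1 - s"
      using s_pos by (cases "s = 1") (auto simp: \<rho>_def power_divide power2_eq_square)
    have descent: "f (y - \<eta> *\<^sub>R \<gamma>) \<le> f y - \<eta> * (G y \<bullet> \<gamma>) + \<eta> / 2 * (\<gamma> \<bullet> \<gamma>)"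
    proof -
      have norm_sq: "(norm (\<eta> *\<^sub>R \<gamma>))\<^sup>2 = \<eta> * (\<eta> * (\<gamma> \<bullet> \<gamma>))"
        unfolding power2_norm_eq_inner by simp
      have "f (y - \<eta> *\<^sub>R \<gamma>) \<le> f y - \<eta> * (G y \<bullet> \<gamma>) + (L * \<eta>) * (\<eta> / 2 * (\<gamma> \<bullet> \<gamma>))"
        using lipschitz_gradient_upper_bound[OF gradient lipschitz, of y "- (\<eta> *\<^sub>R \<gamma>)"]
        unfolding norm_minus_cancel norm_sq by (simp add: algebra_simps)
      moreover have "(L * \<eta>) * (\<eta> / 2 * (\<gamma> \<bullet> \<gamma>)) \<le> 1 * (\<eta> / 2 * (\<gamma> \<bullet> \<gamma>))"
        using L_eta eta_pos by (intro mult_right_mono) auto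
      ultimately show ?thesis by simp
    qed
    \<comment> \<open>The momentum \<open>\<rho>\<close> enters the normal part once through the velocity and once, with factor \<open>s\<close>,
       through the look-ahead point.\<close>
    have normal: "snd (step (x, v) \<gamma>) - P (snd (step (x, v) \<gamma>)) + m *\<^sub>R offset (ahead (step (x, v) \<gamma>))
        = p - a *\<^sub>R N \<gamma>"
    proof -
      have velocity: "snd (step (x, v) \<gamma>) = \<rho> *\<^sub>R (v - a *\<^sub>R \<gamma>)"
        by (simp add: step_def a_def)
      have look_ahead: "ahead (step (x, v) \<gamma>) = y - (a * a) *\<^sub>R \<gamma> + (a * \<rho>) *\<^sub>R (v - a *\<^sub>R \<gamma>)"
        unfolding aa by (simp add: step_def ahead_def y_def a_def)
      have "snd (step (x, v) \<gamma>) - P (snd (step (x, v) \<gamma>)) + m *\<^sub>R offset (ahead (step (x, v) \<gamma>))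
        = (\<rho> + \<rho> * s) *\<^sub>R (N v - a *\<^sub>R N \<gamma>) + m *\<^sub>R D - (s * a) *\<^sub>R N \<gamma>"
        unfolding velocity look_ahead D_def offset_def N_def sma
        by (simp add: P_simps algebra_simps)
      also have "\<dots> = p - a *\<^sub>R N \<gamma>"
        unfolding rho p_def by (simp add: algebra_simps)
      finally show ?thesis .
    qed
    have tangential: "(1 + s)\<^sup>2 / (1 - s) / 2 * (norm (P (snd (step (x, v) \<gamma>))))\<^sup>2
        = (1 - s) / 2 * (norm (P v - a *\<^sub>R P \<gamma>))\<^sup>2"
    proof -
      have "(1 + s)\<^sup>2 / (1 - s) / 2 * (norm (P (snd (step (x, v) \<gamma>))))\<^sup>2
        = ((1 + s)\<^sup>2 / (1 - s) * \<rho>\<^sup>2) / 2 * (norm (P v - a *\<^sub>R P \<gamma>))\<^sup>2"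
        by (simp add: step_def P_simps a_def power_mult_distrib)
      then show ?thesis unfolding weight .
    qed
    have next_energy: "energy (step (x, v) \<gamma>) \<le> f y - f_inf - \<eta> * (G y \<bullet> \<gamma>) + \<eta> / 2 * (\<gamma> \<bullet> \<gamma>)
        + 1 / 2 * (norm (p - a *\<^sub>R N \<gamma>))\<^sup>2 + (1 - s) / 2 * (norm (P v - a *\<^sub>R P \<gamma>))\<^sup>2"
      using descent unfolding energy_def tangential normal[unfolded m_def]
      by (simp add: step_def ahead_def y_def a_def)
    \<comment> \<open>Expand everything in \<open>\<gamma> = G y + \<xi>\<close>, separating normal from tangential components.\<close>
    have e1: "- \<eta> * (G y \<bullet> \<gamma>) + \<eta> / 2 * (\<gamma> \<bullet> \<gamma>) = \<eta> / 2 * (\<xi> \<bullet> \<xi>) - \<eta> / 2 * (G y \<bullet> G y)"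
      unfolding \<gamma> by (simp add: inner_add_left inner_add_right algebra_simps inner_commute)
    have N_add: "N \<gamma> = N (G y) + N \<xi>" by (simp add: N_def \<gamma> P_simps)
    have P_add: "P \<gamma> = P (G y) + P \<xi>" by (simp add: \<gamma> P_simps)
    have e2: "(norm (p - a *\<^sub>R N \<gamma>))\<^sup>2 = p \<bullet> p - 2 * a * (p \<bullet> N (G y)) - 2 * a * (p \<bullet> N \<xi>)
        + \<eta> * (N (G y) \<bullet> N (G y)) + 2 * \<eta> * (N (G y) \<bullet> N \<xi>) + \<eta> * (N \<xi> \<bullet> N \<xi>)"
      unfolding N_add power2_norm_eq_inner aa[symmetric]
      by (simp add: inner_simps algebra_simps inner_commute)
    have e3: "(norm (P v - a *\<^sub>R P \<gamma>))\<^sup>2 = P v \<bullet> P v - 2 * a * (P v \<bullet> P (G y)) - 2 * a * (P v \<bullet> P \<xi>)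
        + \<eta> * (P (G y) \<bullet> P (G y)) + 2 * \<eta> * (P (G y) \<bullet> P \<xi>) + \<eta> * (P \<xi> \<bullet> P \<xi>)"
      unfolding P_add power2_norm_eq_inner aa[symmetric]
      by (simp add: inner_simps algebra_simps inner_commute)
    have e4: "A \<bullet> \<xi> = - a * (p \<bullet> N \<xi>) + \<eta> * (N (G y) \<bullet> N \<xi>)
        + (1 - s) * (\<eta> * (P (G y) \<bullet> P \<xi>) - a * (P v \<bullet> P \<xi>))"
    proof -
      have "p \<bullet> P \<xi> = 0" by (simp add: p_def inner_add_left NP DP)
      then have "p \<bullet> \<xi> = p \<bullet> N \<xi>" by (simp add: N_def inner_diff_right)
      moreover have "N (G y) \<bullet> \<xi> = N (G y) \<bullet> N \<xi>" "P w \<bullet> \<xi> = P w \<bullet> P \<xi>" for w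
        using NP(1)[of "G y" \<xi>] NP(2)[of w \<xi>] by (simp_all add: N_def inner_diff_right)
      ultimately show ?thesis by (simp add: A_def inner_simps)
    qed
    have G_sq: "\<eta> / 2 * (G y \<bullet> G y) = \<eta> / 2 * (N (G y) \<bullet> N (G y)) + \<eta> / 2 * (P (G y) \<bullet> P (G y))"
      by (subst inner_split) (simp add: algebra_simps)
    have xi_sq: "\<eta> / 2 * (\<xi> \<bullet> \<xi>) = \<eta> / 2 * (N \<xi> \<bullet> N \<xi>) + \<eta> / 2 * (P \<xi> \<bullet> P \<xi>)"
      by (subst inner_split) (simp add: algebra_simps)
    \<comment> \<open>The quadratic terms in \<open>N (G y)\<close> cancel. In the tangential ones the coefficient \<open>1 - s\<close>
       falls short of \<open>1\<close>, which is favourable.\<close>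
    have drop: "0 \<le> s * (\<eta> / 2 * (P w \<bullet> P w))" for w
      using s_pos eta_pos by simp
    have noise: "energy (step (x, v) \<gamma>) \<le> f y - f_inf + 1 / 2 * (p \<bullet> p) - a * (p \<bullet> N (G y))
        + (1 - s) / 2 * (P v \<bullet> P v) - (1 - s) * a * (P v \<bullet> P (G y)) + A \<bullet> \<xi> + \<eta> * (\<xi> \<bullet> \<xi>)"
    proof -
      have e3': "(1 - s) / 2 * (norm (P v - a *\<^sub>R P \<gamma>))\<^sup>2 = (1 - s) / 2 * (P v \<bullet> P v)
          - (1 - s) * a * (P v \<bullet> P (G y)) - (1 - s) * a * (P v \<bullet> P \<xi>) + (1 - s) * (\<eta> * (P (G y) \<bullet> P \<xi>))
          + \<eta> / 2 * (P (G y) \<bullet> P (G y)) - s * (\<eta> / 2 * (P (G y) \<bullet> P (G y)))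
          + \<eta> / 2 * (P \<xi> \<bullet> P \<xi>) - s * (\<eta> / 2 * (P \<xi> \<bullet> P \<xi>))"
        unfolding e3 by (simp add: field_simps)
      have e4': "A \<bullet> \<xi> = - a * (p \<bullet> N \<xi>) + \<eta> * (N (G y) \<bullet> N \<xi>)
          + (1 - s) * (\<eta> * (P (G y) \<bullet> P \<xi>)) - (1 - s) * a * (P v \<bullet> P \<xi>)"
        unfolding e4 by (simp add: algebra_simps)
      show ?thesis
        using next_energy e1 G_sq xi_sq drop[of \<xi>] drop[of "G y"] unfolding e2 e3' e4'
        by argo
    qed
    \<comment> \<open>The two linear terms reassemble into the two inner products that the hypotheses bound.\<close>
    have pG: "a * (p \<bullet> N (G y)) + (1 - s) * a * (P v \<bullet> P (G y)) = (1 - s) * (G y \<bullet> (a *\<^sub>R v)) + s * (G y \<bullet> D)"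
      unfolding D_split[of "G y"] inner_split[of "G y" "a *\<^sub>R v"]
      by (simp add: p_def N_def[of "a *\<^sub>R v"] P_simps sma inner_simps algebra_simps inner_commute)
         (simp add: N_def inner_simps algebra_simps inner_commute)
    have conv: "s * (f y - f_inf + \<mu> / 2 * (D \<bullet> D)) \<le> s * (G y \<bullet> D)"
      using convexity[of y] s_pos by (simp add: D_def offset_def power2_norm_eq_inner)
    have almost: "(1 - s) * (f y - f x - s / 2 * (v \<bullet> v)) \<le> (1 - s) * (G y \<bullet> (a *\<^sub>R v))"
    proof (rule mult_left_mono)
      have norm_sq: "(norm (a *\<^sub>R v))\<^sup>2 = \<eta> * (v \<bullet> v)"
        unfolding power2_norm_eq_inner aa[symmetric] by simp
      have "\<epsilon> * \<eta> \<le> sqrt (\<mu> / \<eta>) * \<eta>" using eps_le eta_pos by simp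
      also have "\<dots> = s" using eta_pos mu_pos by (simp add: s_eq real_sqrt_divide real_div_sqrt field_simps)
      finally have "\<epsilon> * \<eta> * (v \<bullet> v) \<le> s * (v \<bullet> v)" by (rule mult_right_mono) simp
      then show "f y - f x - s / 2 * (v \<bullet> v) \<le> G y \<bullet> (a *\<^sub>R v)"
        using almost_convexity[of x "a *\<^sub>R v", folded y_def] norm_sq by (simp add: mult.assoc)
    qed (use s_le_1 in simp)
    have complete_square: "1 / 2 * (p \<bullet> p) - s * (\<mu> / 2 * (D \<bullet> D)) + (1 - s) * (s / 2 * (N v \<bullet> N v))
        = (1 - s) * (1 / 2 * (norm (N v + m *\<^sub>R D))\<^sup>2)"
      unfolding p_def power2_norm_eq_inner mm[symmetric]
      by (simp add: inner_simps inner_commute field_simps)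
    have tang: "(1 - s) * (s / 2 * (P v \<bullet> P v)) + (1 - s) / 2 * (P v \<bullet> P v)
        \<le> (1 - s) * ((1 + s)\<^sup>2 / (1 - s) / 2 * (P v \<bullet> P v))"
    proof (cases "s = 1")
      case False
      have "(1 - s) * (1 + s) \<le> (1 + s)\<^sup>2"
        using s_pos by (simp add: power2_eq_square algebra_simps)
      then have "(1 - s) * (1 + s) * (P v \<bullet> P v) \<le> (1 + s)\<^sup>2 * (P v \<bullet> P v)"
        by (rule mult_right_mono) simp
      moreover have "(1 - s) * ((1 + s)\<^sup>2 / (1 - s) / 2 * (P v \<bullet> P v)) = (1 + s)\<^sup>2 * (P v \<bullet> P v) / 2"
      proof -
        have "d * (k / d / 2 * q) = k * q / 2" if "d \<noteq> 0" for d k q :: real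
          using that by simp
        from this[of "1 - s"] show ?thesis using False by (simp only: right_minus_eq)
      qed
      moreover have "(1 - s) * (s / 2 * (P v \<bullet> P v)) + (1 - s) / 2 * (P v \<bullet> P v)
          = (1 - s) * (1 + s) * (P v \<bullet> P v) / 2"
        by (simp add: field_simps)
      ultimately show ?thesis by linarith
    qed simp
    have old_energy: "(1 - s) * energy (x, v) = (1 - s) * (f x - f_inf)
        + (1 - s) * (1 / 2 * (norm (N v + m *\<^sub>R D))\<^sup>2) + (1 - s) * ((1 + s)\<^sup>2 / (1 - s) / 2 * (P v \<bullet> P v))"
      unfolding energy_def
      by (simp add: distrib_left N_def m_def D_def y_def a_def ahead_def power2_norm_eq_inner)
    have v_sq: "(1 - s) * (s / 2 * (v \<bullet> v)) = (1 - s) * (s / 2 * (N v \<bullet> N v)) + (1 - s) * (s / 2 * (P v \<bullet> P v))"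
      by (subst inner_split) (simp add: algebra_simps)
    have almost': "(1 - s) * (f y - f x) - (1 - s) * (s / 2 * (v \<bullet> v)) \<le> (1 - s) * (G y \<bullet> (a *\<^sub>R v))"
      using almost by (simp only: right_diff_distrib)
    have conv': "s * (f y - f_inf) + s * (\<mu> / 2 * (D \<bullet> D)) \<le> s * (G y \<bullet> D)"
      using conv by (simp only: distrib_left)
    \<comment> \<open>The objective values combine convexly: weight \<open>s\<close> from the strong convexity inequality,
       weight \<open>1 - s\<close> from the one with \<open>\<epsilon>\<close>.\<close>
    have ff: "(1 - s) * (f x - f_inf) = f y - f_inf - s * (f y - f_inf) - (1 - s) * (f y - f x)"
      by (simp add: algebra_simps)
    have "energy (step (x, v) \<gamma>) \<le> (1 - s) * energy (x, v) + A \<bullet> \<xi> + \<eta> * (\<xi> \<bullet> \<xi>)"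
      using noise pG conv' almost' complete_square tang v_sq ff unfolding old_energy by linarith
    then show ?thesis by (simp add: \<xi>_def power2_norm_eq_inner)
  qed
  then show ?thesis unfolding y_def a_def by blast
qed


lemma measurable_P [measurable]: "P \<in> borel_measurable borel"
  using linear_P by (intro borel_measurable_continuous_onI linear_continuous_on)
    (simp add: linear_conv_bounded_linear)

lemma measurable_f [measurable]: "f \<in> borel_measurable borel"
proof (intro borel_measurable_continuous_onI continuous_at_imp_continuous_on ballI)
  show "isCont f y" for y
    using gradient[of y] unfolding gderiv_def by (rule has_derivative_continuous)
qed

lemma measurable_ahead [measurable]: "ahead \<in> borel_measurable borel"
  unfolding borel_prod[symmetric] ahead_def by measurable

lemma measurable_step:
  assumes z: "z \<in> borel_measurable M" and [measurable]: "\<gamma> \<in> borel_measurable M"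
  shows "(\<lambda>m. step (z m) (\<gamma> m)) \<in> borel_measurable M"
proof -
  have [measurable]: "(\<lambda>m. snd (z m)) \<in> borel_measurable M" "(\<lambda>m. ahead (z m)) \<in> borel_measurable M"
    using measurable_compose[OF z[folded borel_prod] measurable_snd]
      measurable_compose[OF z measurable_ahead] by simp_all
  show ?thesis unfolding step_def by (intro borel_measurable_Pair) measurable
qed

lemma measurable_energy [measurable]: "energy \<in> borel_measurable borel"
  unfolding borel_prod[symmetric] energy_def offset_def ahead_def by measurable

lemma expected_energy_step:
  assumes "prob_space Q" and [measurable]: "Y \<in> borel_measurable Q"
    and square: "integrable Q (\<lambda>\<omega>. (norm (Y \<omega>))\<^sup>2)"
    and unbiased: "(\<integral>\<omega>. Y \<omega> \<partial>Q) = G (ahead z)"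
    and variance: "(\<integral>\<omega>. (norm (Y \<omega> - G (ahead z)))\<^sup>2 \<partial>Q) \<le> \<sigma>\<^sup>2"
  shows "(\<integral>\<^sup>+ \<omega>. ennreal (energy (step z (Y \<omega>))) \<partial>Q)
    \<le> ennreal (1 - s) * ennreal (energy z) + ennreal (\<eta> * \<sigma>\<^sup>2)"
proof -
  interpret prob_space Q by fact
  define \<xi> where "\<xi> \<omega> = Y \<omega> - G (ahead z)" for \<omega>
  have [measurable]: "\<xi> \<in> borel_measurable Q" unfolding \<xi>_def by measurable
  have int_Y: "integrable Q Y"
  proof (rule Bochner_Integration.integrable_bound)
    show "integrable Q (\<lambda>\<omega>. 1 + (norm (Y \<omega>))\<^sup>2)" using square by simp
    \<comment> \<open>On a probability space the first moment is dominated by the second.\<close>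
    have "t \<le> 1 + t\<^sup>2" for t :: real
      using zero_le_power2[of "t - 1/2"] by (simp add: power2_eq_square algebra_simps)
    then show "AE \<omega> in Q. norm (Y \<omega>) \<le> norm (1 + (norm (Y \<omega>))\<^sup>2)" by simp
  qed simp
  then have int_xi: "integrable Q \<xi>" and mean_xi: "(\<integral>\<omega>. \<xi> \<omega> \<partial>Q) = 0"
    using unbiased by (simp_all add: \<xi>_def[abs_def] prob_space)
  have int_sq: "integrable Q (\<lambda>\<omega>. (norm (\<xi> \<omega>))\<^sup>2)"
  proof -
    have "(norm (\<xi> \<omega>))\<^sup>2 = (norm (Y \<omega>))\<^sup>2 - 2 * (G (ahead z) \<bullet> Y \<omega>) + (norm (G (ahead z)))\<^sup>2" for \<omega>
      by (simp add: \<xi>_def power2_norm_eq_inner inner_simps inner_commute)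
    then show ?thesis using square int_Y by simp
  qed
  obtain A where A: "\<And>\<gamma>. energy (step z \<gamma>)
      \<le> (1 - s) * energy z + A \<bullet> (\<gamma> - G (ahead z)) + \<eta> * (norm (\<gamma> - G (ahead z)))\<^sup>2"
    using energy_step[of "fst z" "snd z"] by (auto simp: ahead_def)
  define b where "b \<omega> = (1 - s) * energy z + A \<bullet> \<xi> \<omega> + \<eta> * (norm (\<xi> \<omega>))\<^sup>2" for \<omega>
  have b_ge: "energy (step z (Y \<omega>)) \<le> b \<omega>" for \<omega>
    using A[of "Y \<omega>"] by (simp add: b_def \<xi>_def)
  have int_b: "integrable Q b"
    using int_xi int_sq by (simp add: b_def[abs_def])
  have "(\<integral>\<^sup>+ \<omega>. ennreal (energy (step z (Y \<omega>))) \<partial>Q) \<le> (\<integral>\<^sup>+ \<omega>. ennreal (b \<omega>) \<partial>Q)"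
    by (intro nn_integral_mono ennreal_leI b_ge)
  also have "\<dots> = ennreal (\<integral>\<omega>. b \<omega> \<partial>Q)"
    using order_trans[OF energy_nonneg b_ge] by (intro nn_integral_eq_integral int_b) auto
  also have "(\<integral>\<omega>. b \<omega> \<partial>Q) = (1 - s) * energy z + \<eta> * (\<integral>\<omega>. (norm (\<xi> \<omega>))\<^sup>2 \<partial>Q)"
    using int_xi int_sq mean_xi by (simp add: b_def prob_space)
  also have "ennreal \<dots> \<le> ennreal ((1 - s) * energy z + \<eta> * \<sigma>\<^sup>2)"
    using variance eta_pos by (intro ennreal_leI) (simp add: \<xi>_def)
  also have "\<dots> = ennreal (1 - s) * ennreal (energy z) + ennreal (\<eta> * \<sigma>\<^sup>2)"
    using s_le_1 energy_nonneg[of z] eta_pos by (simp add: ennreal_plus ennreal_mult)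
  finally show ?thesis .
qed

end

section \<open>Independence of the state and the next sample\<close>

text \<open>
  The \<open>n\<close>-th iterate depends on the initial value and on the samples before time \<open>n\<close> only, so it
  is measurable with respect to a \<open>\<sigma>\<close>-algebra independent of the \<open>n\<close>-th sample. Independence fixes
  the joint law on rectangles, which determine it.
\<close>

lemma distr_iterate_next_sample:
  assumes "prob_space M" and indep: "indep_initial_samples M A X Q W"
    and h: "h \<in> measurable A S" and F: "F \<in> measurable (S \<Otimes>\<^sub>M Q) S"
    and Z_0: "\<And>m. m \<in> space M \<Longrightarrow> Z 0 m = h (X m)"
    and Z_Suc: "\<And>n m. m \<in> space M \<Longrightarrow> Z (Suc n) m = F (Z n m, W n m)"
  shows "Z n \<in> measurable M S"
    and "distr M (S \<Otimes>\<^sub>M Q) (\<lambda>m. (Z n m, W n m)) = distr M S (Z n) \<Otimes>\<^sub>M distr M Q (W n)"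
proof -
  interpret prob_space M by fact
  define E where "E = case_option {X -` U \<inter> space M |U. U \<in> sets A}
                    (\<lambda>i. {W i -` U \<inter> space M |U. U \<in> sets Q})"
  have X: "X \<in> measurable M A" and W: "\<And>i. W i \<in> measurable M Q" and E_indep: "indep_sets E UNIV"
    using indep by (auto simp: indep_initial_samples_def E_def)
  have E_events: "E i \<subseteq> events" for i
    using E_indep by (auto simp: indep_sets_def)
  have E_stable: "Int_stable (E i)" for i
  proof (cases i)
    case None
    have "\<exists>W. X -` U \<inter> space M \<inter> (X -` V \<inter> space M) = X -` W \<inter> space M \<and> W \<in> sets A"
      if "U \<in> sets A" "V \<in> sets A" for U V
      using that by (intro exI[of _ "U \<inter> V"]) auto
    then show ?thesis using None by (auto simp: E_def Int_stable_def)
  next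
    case (Some k)
    have "\<exists>T. W k -` U \<inter> space M \<inter> (W k -` V \<inter> space M) = W k -` T \<inter> space M \<and> T \<in> sets Q"
      if "U \<in> sets Q" "V \<in> sets Q" for U V
      using that by (intro exI[of _ "U \<inter> V"]) auto
    then show ?thesis using Some by (auto simp: E_def Int_stable_def)
  qed
  \<comment> \<open>\<open>N n\<close> is the information available before the \<open>n\<close>-th sample is drawn.\<close>
  define I where "I n = insert None (Some ` {..<n})" for n :: nat
  define N where "N n = sigma (space M) (\<Union>i\<in>I n. E i)" for n
  have E_Pow: "(\<Union>i\<in>J. E i) \<subseteq> Pow (space M)" for J
    using E_events sets.space_closed by blast
  have space_N: "space (N n) = space M" for n by (simp add: N_def space_measure_of E_Pow)
  have sets_N: "sets (N n) = sigma_sets (space M) (\<Union>i\<in>I n. E i)" for n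
    by (simp add: N_def sets_measure_of E_Pow)
  have E_in_N: "B \<in> sets (N n)" if "B \<in> E i" "i \<in> I n" for B i n
    using that by (auto simp: sets_N)
  have N_mono: "sets (N n) \<subseteq> sets (N (Suc n))" for n
    unfolding sets_N by (intro sigma_sets_mono') (auto simp: I_def)
  have Z_N: "Z n \<in> measurable (N n) S" for n
  proof (induction n)
    case 0
    have "X \<in> measurable (N 0) A"
    proof (rule measurableI)
      show "X -` U \<inter> space (N 0) \<in> sets (N 0)" if "U \<in> sets A" for U
        using that by (intro E_in_N[of _ None]) (auto simp: E_def I_def space_N)
    qed (use X in \<open>auto simp: space_N measurable_space\<close>)
    then have "(\<lambda>m. h (X m)) \<in> measurable (N 0) S" using h by (rule measurable_compose)
    then show ?case by (rule measurable_cong[THEN iffD2, rotated]) (simp add: space_N Z_0)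
  next
    case (Suc n)
    have "W n \<in> measurable (N (Suc n)) Q"
    proof (rule measurableI)
      show "W n -` U \<inter> space (N (Suc n)) \<in> sets (N (Suc n))" if "U \<in> sets Q" for U
        using that by (intro E_in_N[of _ "Some n"]) (auto simp: E_def I_def space_N)
    qed (use measurable_space[OF W] in \<open>auto simp: space_N\<close>)
    moreover have "Z n \<in> measurable (N (Suc n)) S"
      using Suc measurable_mono[OF order_refl refl N_mono] by (auto simp: space_N)
    ultimately have "(\<lambda>m. F (Z n m, W n m)) \<in> measurable (N (Suc n)) S"
      by (intro measurable_compose[OF measurable_Pair F])
    then show ?case by (rule measurable_cong[THEN iffD2, rotated]) (simp add: space_N Z_Suc)
  qed
  have N_events: "sets (N n) \<subseteq> events" for n
    unfolding sets_N using E_events by (intro sets.sigma_sets_subset) auto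
  show Z_M: "Z n \<in> measurable M S"
    using Z_N[of n] measurable_mono[OF order_refl refl N_events] by (auto simp: space_N)
  have "indep_sets (\<lambda>j. sigma_sets (space M) (\<Union>i\<in>case_bool (I n) {Some n} j. E i)) UNIV"
    by (rule indep_sets_collect_sigma)
       (use E_stable in \<open>auto intro: indep_sets_mono_index[OF _ E_indep]
          simp: disjoint_family_on_def I_def split: bool.splits\<close>)
  then have past_future: "indep_set (sets (N n)) (sigma_sets (space M) (E (Some n)))"
    unfolding indep_set_def
    by (rule indep_sets_mono_sets) (auto simp: sets_N split: bool.splits)
  then have product: "prob (B \<inter> C) = prob B * prob C" if "B \<in> sets (N n)" "C \<in> E (Some n)" for B C
    using that by (intro indep_setD[OF past_future]) auto
  have "distr M S (Z n) \<Otimes>\<^sub>M distr M Q (W n) = distr M (S \<Otimes>\<^sub>M Q) (\<lambda>m. (Z n m, W n m))"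
  proof (rule pair_measure_eqI)
    show "sigma_finite_measure (distr M S (Z n))" "sigma_finite_measure (distr M Q (W n))"
      using Z_M W by (auto intro!: prob_space_imp_sigma_finite prob_space_distr)
    fix B C assume BC: "B \<in> sets (distr M S (Z n))" "C \<in> sets (distr M Q (W n))"
    have B_N: "Z n -` B \<inter> space M \<in> sets (N n)"
      using measurable_sets[OF Z_N, of B n] BC by (simp add: space_N)
    have C_E: "W n -` C \<inter> space M \<in> E (Some n)" using BC by (auto simp: E_def)
    have pre: "(\<lambda>m. (Z n m, W n m)) -` (B \<times> C) \<inter> space M
        = (Z n -` B \<inter> space M) \<inter> (W n -` C \<inter> space M)" by auto
    show "emeasure (distr M S (Z n)) B * emeasure (distr M Q (W n)) C
      = emeasure (distr M (S \<Otimes>\<^sub>M Q) (\<lambda>m. (Z n m, W n m))) (B \<times> C)"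
      using BC Z_M W product[OF B_N C_E]
      by (simp add: emeasure_distr pre measurable_Pair emeasure_eq_measure ennreal_mult)
  qed simp
  then show "distr M (S \<Otimes>\<^sub>M Q) (\<lambda>m. (Z n m, W n m)) = distr M S (Z n) \<Otimes>\<^sub>M distr M Q (W n)" by simp
qed

section \<open>Convergence in expectation\<close>

text \<open>The constant \<open>B\<close> is the fixed point of the recursion \<open>b = q b + (1 - q) B\<close>.\<close>

lemma ennreal_affine_recursion_bound:
  fixes a :: "nat \<Rightarrow> ennreal"
  assumes "0 \<le> q" "q \<le> 1" "0 \<le> B"
    and step: "\<And>n. a (Suc n) \<le> ennreal q * a n + ennreal ((1 - q) * B)"
  shows "a n \<le> ennreal (q ^ n) * a 0 + ennreal B"
proof (induction n)
  case (Suc n)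
  have "a (Suc n) \<le> ennreal q * (ennreal (q ^ n) * a 0 + ennreal B) + ennreal ((1 - q) * B)"
    using Suc by (intro order_trans[OF step] add_right_mono mult_left_mono) auto
  also have "\<dots> = ennreal q * ennreal (q ^ n) * a 0 + (ennreal (q * B) + ennreal ((1 - q) * B))"
    using assms by (simp add: distrib_left ennreal_mult add.assoc mult.assoc)
  also have "\<dots> = ennreal (q ^ Suc n) * a 0 + ennreal B"
    using assms by (simp flip: ennreal_mult ennreal_plus) (simp add: algebra_simps)
  finally show ?case .
qed (use assms in simp)

theorem theorem13:
  fixes f :: "real ^ 'd \<Rightarrow> real"
    and nabla_f :: "real ^ 'd \<Rightarrow> real ^ 'd"
    and V :: "(real ^ 'd) set"
    and P \<pi> :: "real ^ 'd \<Rightarrow> real ^ 'd"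
    and x_star :: "real ^ 'd"
    and L \<mu> \<eta> \<rho> \<epsilon> \<sigma> :: real
    and Q :: "'w measure"
    and g :: "real ^ 'd \<Rightarrow> 'w \<Rightarrow> real ^ 'd"
    and M :: "'m measure"
    and W :: "nat \<Rightarrow> 'm \<Rightarrow> 'w"
    and x x' v gr :: "nat \<Rightarrow> 'm \<Rightarrow> real ^ 'd"
  assumes gradient: "\<And>y. GDERIV f y :> nabla_f y"
    and gradient_continuous: "continuous_on UNIV nabla_f"
    and L_pos: "L > 0"
    and gradient_lipschitz: "L-lipschitz_on UNIV nabla_f"
    and bounded_below: "bdd_below (range f)"
    and mu_pos: "\<mu> > 0"
    and eta: "0 < \<eta>" "\<eta> \<le> 1 / L"
    and rho: "\<rho> = (1 - sqrt (\<mu> * \<eta>)) / (1 + sqrt (\<mu> * \<eta>))"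
    and V_subspace: "subspace V"
    and V_dim: "dim V < CARD('d)"
    and P_projection: "is_orthogonal_projection V P"
    and x_star_min_norm: "is_arg_min norm (\<lambda>y. y \<in> (\<lambda>u. x_star + u) ` V) x_star"
    and minimizers_affine: "minimizers f = (\<lambda>u. x_star + u) ` V"
    and pi_closest_point: "\<And>y. \<pi> y = closest_point (minimizers f) y"
    and pi_affine: "\<And>y. \<pi> y = P y + x_star"
    and strong_convexity_wrt_minimizers:
      "\<And>y. nabla_f y \<bullet> (y - \<pi> y) \<ge> f y - f (\<pi> y) + \<mu> / 2 * (norm (y - \<pi> y))\<^sup>2"
    and eps_le: "\<epsilon> \<le> sqrt (\<mu> / \<eta>)"
    and almost_convexity:
      "\<And>y u. nabla_f (y + u) \<bullet> u \<ge> f (y + u) - f y - \<epsilon> / 2 * (norm u)\<^sup>2"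
    and Q_prob: "prob_space Q"
    and g_measurable: "(\<lambda>(y, \<omega>). g y \<omega>) \<in> borel_measurable (borel \<Otimes>\<^sub>M Q)"
    and g_unbiased: "\<And>y. (\<integral>\<omega>. g y \<omega> \<partial>Q) = nabla_f y"
    and g_square_integrable: "\<And>y. integrable Q (\<lambda>\<omega>. (norm (g y \<omega>))\<^sup>2)"
    and sigma_nonneg: "\<sigma> \<ge> 0"
    and g_variance: "\<And>y. (\<integral>\<omega>. (norm (g y \<omega> - nabla_f y))\<^sup>2 \<partial>Q) \<le> \<sigma>\<^sup>2"
    and M_prob: "prob_space M"
    and W_law: "\<And>i. distr M Q (W i) = Q"
    and independence: "indep_initial_samples M borel (x 0) Q W"
    and v_init: "\<And>m. m \<in> space M \<Longrightarrow> v 0 m = 0"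
    and x'_step: "\<And>n m. m \<in> space M \<Longrightarrow> x' n m = x n m + sqrt \<eta> *\<^sub>R v n m"
    and gr_step: "\<And>n m. m \<in> space M \<Longrightarrow> gr n m = g (x' n m) (W n m)"
    and x_step: "\<And>n m. m \<in> space M \<Longrightarrow> x (Suc n) m = x' n m - \<eta> *\<^sub>R gr n m"
    and v_step: "\<And>n m. m \<in> space M \<Longrightarrow> v (Suc n) m = \<rho> *\<^sub>R (v n m - sqrt \<eta> *\<^sub>R gr n m)"
  shows "\<forall>n.
    (\<integral>\<^sup>+ m. ennreal (f (x n m) - (INF z. f z)) \<partial>M)
      \<le> ennreal ((1 - sqrt (\<mu> * \<eta>)) ^ n) *
          (\<integral>\<^sup>+ m. ennreal (f (x 0 m) - (INF z. f z)
                        + \<mu> / 2 * (norm (x 0 m - \<pi> (x 0 m)))\<^sup>2) \<partial>M)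
        + ennreal (\<sigma>\<^sup>2 * sqrt \<eta> / sqrt \<mu>)"
proof
  fix n
  define f_inf where "f_inf = (INF z. f z)"
  have lower: "f_inf \<le> f y" for y
    unfolding f_inf_def by (rule cINF_lower[OF bounded_below]) simp
  have P_V: "P y \<in> V" for y
    using P_projection by (simp add: is_orthogonal_projection_def)
  have linear_P: "linear P"
    by (rule orthogonal_projection_linear[OF V_subspace P_projection])
  have x_star_min: "x_star \<in> minimizers f"
    unfolding minimizers_affine using subspace_0[OF V_subspace] by (auto intro: image_eqI[of _ _ 0])
  have P_x_star: "P x_star = 0"
    using pi_affine[of x_star] pi_closest_point[of x_star] closest_point_self[OF x_star_min] by simp
  have pi_min: "f (\<pi> y) = f_inf" for y
  proof -
    have "\<pi> y \<in> minimizers f"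
      unfolding minimizers_affine pi_affine using P_V[of y] by (auto simp: add.commute)
    then show ?thesis by (simp add: minimizers_def f_inf_def)
  qed
  have convexity: "nabla_f y \<bullet> (y - (P y + x_star))
      \<ge> f y - f_inf + \<mu> / 2 * (norm (y - (P y + x_star)))\<^sup>2" for y
    using strong_convexity_wrt_minimizers[of y] unfolding pi_min unfolding pi_affine .
  \<comment> \<open>The minimizers form a proper affine subspace, so some point is not its own projection.\<close>
  have "\<mu> \<le> L"
  proof -
    have "V \<noteq> UNIV" using V_dim by (auto simp: dim_UNIV)
    then obtain u where u: "u \<notin> V" by auto
    have "P (x_star + u) + x_star \<noteq> x_star + u"
      using u P_V[of "x_star + u"] by (auto simp: add.commute)
    then show ?thesis
      by (rule quasi_strong_convexity_modulus_le[OF gradient gradient_lipschitz L_pos lower _ convexity])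
  qed
  have L_eta: "L * \<eta> \<le> 1" using eta L_pos by (simp add: field_simps)
  have "\<mu> * \<eta> \<le> L * \<eta>" using \<open>\<mu> \<le> L\<close> eta by simp
  then have mu_eta: "\<mu> * \<eta> \<le> 1" using L_eta by linarith
  interpret nesterov: nesterov f nabla_f P x_star f_inf L \<mu> \<eta> \<epsilon>
  proof (rule nesterov.intro)
    show "(u - P u) \<bullet> P w = 0" for u w
      using P_projection P_V by (simp add: is_orthogonal_projection_def orthogonal_def)
  qed (fact gradient gradient_lipschitz lower linear_P P_x_star mu_pos eta L_eta mu_eta convexity
      eps_le almost_convexity)+
  define Z where "Z n m = (x n m, v n m)" for n m
  define F where "F = (\<lambda>(z, \<omega>). nesterov.step z (g (nesterov.ahead z) \<omega>))"
  have rho_eq: "\<rho> = nesterov.\<rho>" by (simp add: rho nesterov.\<rho>_def nesterov.s_def)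
  have Z_Suc: "Z (Suc n) m = F (Z n m, W n m)" if "m \<in> space M" for n m
    using that
    by (simp add: Z_def F_def nesterov.step_def nesterov.ahead_def x_step v_step gr_step x'_step rho_eq)
  have Z_0: "Z 0 m = (x 0 m, 0)" if "m \<in> space M" for m
    using that by (simp add: Z_def v_init)
  have g_ahead [measurable]: "(\<lambda>p. g (nesterov.ahead (fst p)) (snd p)) \<in> borel_measurable (borel \<Otimes>\<^sub>M Q)"
    using measurable_compose[OF _ g_measurable,
        of "\<lambda>p. (nesterov.ahead (fst p), snd p)" "borel \<Otimes>\<^sub>M Q"] by simp
  have F_measurable: "F \<in> borel_measurable (borel \<Otimes>\<^sub>M Q)"
    unfolding F_def case_prod_beta by (intro nesterov.measurable_step) measurable
  note iterate = distr_iterate_next_sample[where Z=Z and S=borel and h="\<lambda>y. (y, 0)",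
      OF M_prob independence _ F_measurable Z_0 Z_Suc]
  have energy_step: "(\<integral>\<^sup>+ m. ennreal (nesterov.energy (Z (Suc n) m)) \<partial>M)
      \<le> ennreal (1 - nesterov.s) * (\<integral>\<^sup>+ m. ennreal (nesterov.energy (Z n m)) \<partial>M) + ennreal (\<eta> * \<sigma>\<^sup>2)" for n
  proof -
    interpret Q: prob_space Q by fact
    have Z_M [measurable]: "Z n \<in> borel_measurable M" by (rule iterate(1)) auto
    have W_M [measurable]: "W n \<in> measurable M Q"
      using independence by (simp add: indep_initial_samples_def)
    have joint: "distr M (borel \<Otimes>\<^sub>M Q) (\<lambda>m. (Z n m, W n m)) = distr M borel (Z n) \<Otimes>\<^sub>M Q"
      using iterate(2)[of n] by (simp add: W_law)
    have energy_F: "(\<lambda>p. ennreal (nesterov.energy (F p))) \<in> borel_measurable (borel \<Otimes>\<^sub>M Q)"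
      using F_measurable by measurable
    have "(\<integral>\<^sup>+ m. ennreal (nesterov.energy (Z (Suc n) m)) \<partial>M)
        = (\<integral>\<^sup>+ m. ennreal (nesterov.energy (F (Z n m, W n m))) \<partial>M)"
      by (intro nn_integral_cong) (simp add: Z_Suc)
    also have "\<dots> = (\<integral>\<^sup>+ p. ennreal (nesterov.energy (F p)) \<partial>distr M (borel \<Otimes>\<^sub>M Q) (\<lambda>m. (Z n m, W n m)))"
      using energy_F by (subst nn_integral_distr) auto
    also have "\<dots> = (\<integral>\<^sup>+ z. \<integral>\<^sup>+ \<omega>. ennreal (nesterov.energy (F (z, \<omega>))) \<partial>Q \<partial>distr M borel (Z n))"
      unfolding joint using energy_F by (subst Q.nn_integral_fst[symmetric]) (auto cong: measurable_cong_sets)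
    also have "\<dots> \<le> (\<integral>\<^sup>+ z. ennreal (1 - nesterov.s) * ennreal (nesterov.energy z) + ennreal (\<eta> * \<sigma>\<^sup>2)
        \<partial>distr M borel (Z n))"
    proof (rule nn_integral_mono)
      fix z :: "(real ^ 'd) \<times> (real ^ 'd)"
      have "g (nesterov.ahead z) \<in> borel_measurable Q"
        using measurable_compose[OF measurable_Pair1' g_measurable, of "nesterov.ahead z"] by simp
      then show "(\<integral>\<^sup>+ \<omega>. ennreal (nesterov.energy (F (z, \<omega>))) \<partial>Q)
          \<le> ennreal (1 - nesterov.s) * ennreal (nesterov.energy z) + ennreal (\<eta> * \<sigma>\<^sup>2)"
        unfolding F_def prod.case
        by (intro nesterov.expected_energy_step Q_prob g_square_integrable g_unbiased g_variance)
    qed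
    also have "\<dots> = (\<integral>\<^sup>+ m. ennreal (1 - nesterov.s) * ennreal (nesterov.energy (Z n m)) + ennreal (\<eta> * \<sigma>\<^sup>2) \<partial>M)"
      by (subst nn_integral_distr) auto
    also have "\<dots> = ennreal (1 - nesterov.s) * (\<integral>\<^sup>+ m. ennreal (nesterov.energy (Z n m)) \<partial>M) + ennreal (\<eta> * \<sigma>\<^sup>2)"
      using prob_space.emeasure_space_1[OF M_prob] by (simp add: nn_integral_add nn_integral_cmult)
    finally show ?thesis .
  qed
  define B where "B = \<sigma>\<^sup>2 * sqrt \<eta> / sqrt \<mu>"
  have B: "0 \<le> B" "\<eta> * \<sigma>\<^sup>2 = (1 - (1 - nesterov.s)) * B"
    using eta mu_pos by (simp_all add: B_def nesterov.s_eq)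
  have initial: "nesterov.energy (Z 0 m)
      = f (x 0 m) - f_inf + \<mu> / 2 * (norm (x 0 m - \<pi> (x 0 m)))\<^sup>2" if "m \<in> space M" for m
    using mu_pos linear_0[OF linear_P]
    by (simp add: Z_0[OF that] nesterov.energy_def nesterov.ahead_def nesterov.offset_def pi_affine
        power_mult_distrib)
  have "(\<integral>\<^sup>+ m. ennreal (f (x n m) - f_inf) \<partial>M) \<le> (\<integral>\<^sup>+ m. ennreal (nesterov.energy (Z n m)) \<partial>M)"
    using nesterov.energy_ge[of "Z n m" for m] by (intro nn_integral_mono ennreal_leI) (simp add: Z_def)
  also have "\<dots> \<le> ennreal ((1 - nesterov.s) ^ n) * (\<integral>\<^sup>+ m. ennreal (nesterov.energy (Z 0 m)) \<partial>M) + ennreal B"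
    using nesterov.s_le_1 nesterov.s_pos B energy_step
    by (intro ennreal_affine_recursion_bound[where a="\<lambda>n. \<integral>\<^sup>+ m. ennreal (nesterov.energy (Z n m)) \<partial>M"]) auto
  also have "(\<integral>\<^sup>+ m. ennreal (nesterov.energy (Z 0 m)) \<partial>M)
      = (\<integral>\<^sup>+ m. ennreal (f (x 0 m) - f_inf + \<mu> / 2 * (norm (x 0 m - \<pi> (x 0 m)))\<^sup>2) \<partial>M)"
    by (intro nn_integral_cong) (simp add: initial)
  finally show "(\<integral>\<^sup>+ m. ennreal (f (x n m) - (INF z. f z)) \<partial>M)
      \<le> ennreal ((1 - sqrt (\<mu> * \<eta>)) ^ n) *
          (\<integral>\<^sup>+ m. ennreal (f (x 0 m) - (INF z. f z)
                        + \<mu> / 2 * (norm (x 0 m - \<pi> (x 0 m)))\<^sup>2) \<partial>M)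
        + ennreal (\<sigma>\<^sup>2 * sqrt \<eta> / sqrt \<mu>)"
    by (simp add: f_inf_def B_def nesterov.s_def)
qed

end
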